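(* Let the prime $p$ be fixed. Then for all integers $n \ge 1$, $$\nu_p(\overline{G}_n) := \mathrm{ord}_p(\overline{G}_n) = \frac{1}{p-1}\Big(2 S_p(n) - (n-1)\, d_p(n)\Big).$$
   Context: $\overline{G}_n := \prod_{k=0}^n \binom{n}{k}$. For a prime $p$ and a positive integer $m$, $\mathrm{ord}_p(m)$ is the exponent of the largest power of $p$ dividing $m$. For an integer $b \ge 2$ and an integer $m \ge 0$, $d_b(m)$ is the sum of the digits of $m$ in its base $b$ expansion (so $d_b(0)=0$), and $S_b(n) := \sum_{j=0}^{n-1} d_b(j)$. *)

theory Defs
  imports Complex_Main "HOL-Computational_Algebra.Primes"
begin

definition binom_prod :: "nat \<Rightarrow> nat" where
  "binom_prod n = (\<Prod>k=0..n. n choose k)"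

definition digit :: "nat \<Rightarrow> nat \<Rightarrow> nat \<Rightarrow> nat" where
  "digit b m i = m div b ^ i mod b"

(* For b >= 2 the index set is finite and consists exactly of the positions up to the
   leading digit of m; it is empty for m = 0.  The definition is meaningless for b < 2. *)
definition digit_sum :: "nat \<Rightarrow> nat \<Rightarrow> nat" where
  "digit_sum b m = (\<Sum>i | b ^ i \<le> m. digit b m i)"

definition digit_sum_total :: "nat \<Rightarrow> nat \<Rightarrow> nat" where
  "digit_sum_total b n = (\<Sum>j<n. digit_sum b j)"

lemma finite_digit_positions:
  assumes "b \<ge> 2"
  shows "finite {i. b ^ i \<le> (m::nat)}"
proof (rule finite_subset)
  show "{i. b ^ i \<le> m} \<subseteq> {..m}"
  proof
    fix i assume "i \<in> {i. b ^ i \<le> m}"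
    moreover have "i < b ^ i" using assms by (intro power_gt_expt) auto
    ultimately show "i \<in> {..m}" by auto
  qed
qed simp

lemma digit_sum_0: "digit_sum b 0 = 0"
  by (simp add: digit_sum_def digit_def)

lemma digit_sum_rec:
  assumes "b \<ge> 2" "m > 0"
  shows "digit_sum b m = m mod b + digit_sum b (m div b)"
proof -
  have *: "{i. b ^ i \<le> m} = insert 0 (Suc ` {i. b ^ i \<le> m div b})"
  proof (rule set_eqI)
    fix i
    show "i \<in> {i. b ^ i \<le> m} \<longleftrightarrow> i \<in> insert 0 (Suc ` {i. b ^ i \<le> m div b})"
      using assms by (cases i) (auto simp: less_eq_div_iff_mult_less_eq mult.commute)
  qed
  have "digit_sum b m = digit b m 0 + (\<Sum>i\<in>Suc ` {i. b ^ i \<le> m div b}. digit b m i)"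
    unfolding digit_sum_def * using finite_digit_positions[OF assms(1)] by (subst sum.insert) auto
  also have "(\<Sum>i\<in>Suc ` {i. b ^ i \<le> m div b}. digit b m i) = digit_sum b (m div b)"
    unfolding digit_sum_def by (subst sum.reindex) (auto simp: digit_def div_mult2_eq)
  finally show ?thesis by (simp add: digit_def)
qed

end

theory Submission
  imports Defs
begin

text \<open>
  Adding \<open>1\<close> to \<open>m\<close> turns the trailing digits \<open>p - 1\<close> of \<open>m\<close> into zeros and raises
  the next digit by one. The number of these trailing digits is the exponent of \<open>p\<close> in \<open>m + 1\<close>,
  so \<open>p - 1\<close> times this exponent is \<open>d m + 1 - d (m + 1)\<close>, where \<open>d\<close> denotes the digit sum in
  base \<open>p\<close> (lemma \<open>digit_sum_Suc\<close>). Telescoping gives Legendre's formula: \<open>p - 1\<close> times the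
  exponent of \<open>p\<close> in \<open>n!\<close> is \<open>n - d n\<close>.

  The products of the rows of Pascal's triangle satisfy
  \<open>G (n + 1) = G n * (n + 1) ^ n / n!\<close>. With the two formulas above, \<open>p - 1\<close> times the exponent of
  \<open>p\<close> therefore grows from \<open>G n\<close> to \<open>G (n + 1)\<close> by
  \<open>n * (d n + 1 - d (n + 1)) - (n - d n) = (n + 1) * d n - n * d (n + 1)\<close>.
  This is also the growth of \<open>2 * S n - (n - 1) * d n\<close>, where \<open>S n\<close> is the sum of
  \<open>d j\<close> over \<open>j < n\<close>, because \<open>S\<close> grows by \<open>d n\<close>; both quantities vanish at \<open>n = 0\<close>.
\<close>

text \<open>
  The induction strips the last digit: if it is not \<open>b - 1\<close>, there is no carry and \<open>b\<close> does
  not divide \<open>m + 1\<close>; otherwise it drops by \<open>b - 1\<close>, the carry increments \<open>m div b\<close>, and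
  \<open>m + 1\<close> has exactly one factor \<open>b\<close> more than \<open>m div b + 1\<close>.
\<close>
lemma digit_sum_Suc:
  assumes b: "b \<ge> 2"
  shows "(b - 1) * multiplicity b (Suc m) + digit_sum b (Suc m) = Suc (digit_sum b m)"
proof (induction m rule: less_induct)
  case (less m)
  have split_m: "digit_sum b m = m mod b + digit_sum b (m div b)"
    using digit_sum_rec[OF b, of m] by (cases "m = 0") (simp_all add: digit_sum_0)
  have split_Suc: "digit_sum b (Suc m) = Suc m mod b + digit_sum b (Suc m div b)"
    using digit_sum_rec[OF b, of "Suc m"] by simp
  show ?case
  proof (cases "b dvd Suc m")
    case False
    then have "Suc m mod b = Suc (m mod b)" "Suc m div b = m div b"
      by (auto simp: mod_Suc div_Suc dvd_eq_mod_eq_0 split: if_splits)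
    with False split_m split_Suc show ?thesis
      by (simp add: not_dvd_imp_multiplicity_0)
  next
    case True
    have last: "m mod b = b - 1" and carry: "Suc m div b = Suc (m div b)"
      using True by (auto simp: mod_Suc div_Suc dvd_eq_mod_eq_0 split: if_splits)
    have "m \<noteq> 0"
      using True b by (intro notI) simp
    then have IH: "(b - 1) * multiplicity b (Suc (m div b)) + digit_sum b (Suc (m div b)) =
        Suc (digit_sum b (m div b))"
      using less.IH[of "m div b"] b by simp
    have "Suc m = b * Suc (m div b)"
      using True carry by (metis dvd_mult_div_cancel)
    then have "multiplicity b (Suc m) = Suc (multiplicity b (Suc (m div b)))"
      using b by (metis Suc_1 Suc_n_not_le_n multiplicity_times_same nat.distinct(1)
          nat_dvd_1_iff_1 not_less_eq_eq mult_0)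
    with IH split_m split_Suc True last carry b show ?thesis
      by (simp add: dvd_eq_mod_eq_0)
  qed
qed

lemma legendre_formula:
  assumes "prime p"
  shows "(p - 1) * multiplicity p (fact n :: nat) + digit_sum p n = n"
proof (induction n)
  case 0
  then show ?case
    by (simp add: digit_sum_0)
next
  case (Suc n)
  have "multiplicity p (fact (Suc n) :: nat) =
      multiplicity p (Suc n) + multiplicity p (fact n :: nat)"
    unfolding fact_Suc using assms
    by (simp add: prime_elem_multiplicity_mult_distrib del: mult_Suc)
  with Suc digit_sum_Suc[OF prime_ge_2_nat[OF assms], of n] show ?case
    by (simp add: algebra_simps)
qed

text \<open>
  Multiply the absorption identity
  \<open>(Suc n - k) * (Suc n choose k) = Suc n * (n choose k)\<close> over \<open>k \<le> n\<close>; the factors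
  \<open>Suc n - k\<close> make up \<open>(n + 1)!\<close>, and a factor \<open>Suc n\<close> cancels.
\<close>
lemma binom_prod_Suc: "binom_prod (Suc n) * fact n = binom_prod n * Suc n ^ n"
proof -
  have "(\<Prod>k=0..n. Suc n - k) = (\<Prod>k=0..n. Suc k)"
    using prod.atLeastAtMost_rev[of Suc 0 n] by (simp add: Suc_diff_le)
  also have "\<dots> = fact (Suc n)"
    by (simp add: fact_prod_Suc atLeastLessThanSuc_atLeastAtMost del: fact_Suc)
  finally have factorial: "(\<Prod>k=0..n. Suc n - k) = fact (Suc n)" .
  have "Suc n * (binom_prod (Suc n) * fact n) =
      (\<Prod>k=0..n. Suc n choose k) * (\<Prod>k=0..n. Suc n - k)"
    unfolding factorial by (simp add: binom_prod_def algebra_simps)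
  also have "\<dots> = (\<Prod>k=0..n. Suc n * (n choose k))"
    unfolding prod.distrib[symmetric]
    by (intro prod.cong refl) (metis binomial_absorb_comp diff_Suc_1 mult.commute)
  also have "\<dots> = Suc n * (binom_prod n * Suc n ^ n)"
    by (simp add: binom_prod_def prod.distrib algebra_simps del: mult_Suc)
  finally show ?thesis
    by (simp only: mult_cancel1) simp
qed

text \<open>
  The negative terms are moved to the other side, so that the equation lives in the natural
  numbers and the induction can start at \<open>n = 0\<close>.
\<close>
lemma multiplicity_binom_prod:
  assumes "prime p"
  shows "(p - 1) * multiplicity p (binom_prod n) + n * digit_sum p n =
    2 * digit_sum_total p n + digit_sum p n"
proof (induction n)
  case 0
  show ?case
    by (simp add: binom_prod_def digit_sum_0 digit_sum_total_def)
next
  case (Suc n)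
  have pos: "binom_prod k \<noteq> 0" for k
    by (simp add: binom_prod_def)
  have "multiplicity p (binom_prod (Suc n)) + multiplicity p (fact n :: nat) =
      multiplicity p (binom_prod (Suc n) * fact n)"
    using assms pos by (simp add: prime_elem_multiplicity_mult_distrib)
  also have "\<dots> = multiplicity p (binom_prod n) + n * multiplicity p (Suc n)"
    unfolding binom_prod_Suc using assms pos
    by (simp add: prime_elem_multiplicity_mult_distrib prime_elem_multiplicity_power_distrib
        del: power_Suc)
  finally have "(p - 1) * multiplicity p (binom_prod (Suc n)) +
      (p - 1) * multiplicity p (fact n :: nat) =
      (p - 1) * multiplicity p (binom_prod n) + n * ((p - 1) * multiplicity p (Suc n))"
    by (metis add_mult_distrib2 mult.left_commute)
  moreover have "n * ((p - 1) * multiplicity p (Suc n)) + n * digit_sum p (Suc n) =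
      n + n * digit_sum p n"
    using arg_cong[OF digit_sum_Suc[OF prime_ge_2_nat[OF assms], of n], of "(*) n"]
    by (simp add: add_mult_distrib2)
  moreover have "digit_sum_total p (Suc n) = digit_sum_total p n + digit_sum p n"
    by (simp add: digit_sum_total_def)
  ultimately show ?case
    using Suc legendre_formula[OF assms, of n] unfolding mult_Suc by linarith
qed

theorem theorem5p1:
  fixes p n :: nat
  assumes "prime p" and "n \<ge> 1"
  shows "real (multiplicity p (binom_prod n)) =
    1 / (real p - 1) * (2 * real (digit_sum_total p n) - (real n - 1) * real (digit_sum p n))"
proof -
  have "p > 1"
    using assms(1) by (rule prime_gt_1_nat)
  then have "(real p - 1) * real (multiplicity p (binom_prod n)) + real n * real (digit_sum p n) =
      2 * real (digit_sum_total p n) + real (digit_sum p n)"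
    using arg_cong[OF multiplicity_binom_prod[OF assms(1), of n], of real]
    by (simp add: of_nat_diff)
  with \<open>p > 1\<close> show ?thesis
    by (simp add: field_simps)
qed

end
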